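(* Let $L>3$ be an integer and let $\alpha,\varphi,\psi\in\mathbb R$ with $\alpha\ne0$, $\varphi\neq\pm1$ and $\alpha\varphi^L\ne1$. Let $C\in\mathbb R^{L\times L}$ be the matrix with all diagonal entries equal to $1$, all first-subdiagonal entries equal to $-\varphi$, top-right entry (row $1$, column $L$) equal to $-\alpha\varphi$, and all other entries $0$. Let $I$ be the $L\times L$ identity matrix, and let $R\in\mathbb R^{2L\times2L}$ be the matrix whose only (potentially) non-zero entries are: $\alpha\varphi$ in row $1$, column $L$; $-1$ in row $2L$, column $L$; and $\alpha\varphi$ in row $2L$, column $L+1$. Then the $2L\times 2L$ matrix $$M=\begin{bmatrix}C&\psi I\\0&C^\top\end{bmatrix}^{-1}R$$ has two potentially non-zero eigenvalues $\omega_1,\omega_2$ (all its other eigenvalues, counted with algebraic multiplicity, are zero), namely those of the matrix $$M_{\mathrm{red}}=\begin{bmatrix}\dfrac{\alpha\varphi^L}{1-\alpha\varphi^L}+\dfrac{\psi}{(1-\alpha\varphi^L)^2}\dfrac{1-\varphi^{2L}}{1-\varphi^2}&-\dfrac{\alpha\varphi\psi}{(1-\alpha\varphi^L)^2}\dfrac{1-\varphi^{2L}}{1-\varphi^2}\\[2ex]-\dfrac{\varphi^{L-1}}{1-\alpha\varphi^L}&\dfrac{\alpha\varphi^L}{1-\alpha\varphi^L}\end{bmatrix}.$$ When $\alpha$ goes to zero (with $L,\varphi,\psi$ fixed, and with a suitable labelling of the two eigenvalues), this simplifies to $$\lim_{\alpha\to0}\omega_1=\psi\frac{1-\varphi^{2L}}{1-\varphi^2}\qquad\text{and}\qquad\lim_{\alpha\to0}\omega_2=0.$$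 *)

theory Defs
  imports
    Complex_Main
    "HOL-Computational_Algebra.Polynomial"
    "Jordan_Normal_Form.Char_Poly"
    "Jordan_Normal_Form.Gauss_Jordan_Elimination"
begin

text \<open>Matrix indices start at 0, so row or column \<open>k\<close> of the usual notation is index \<open>k - 1\<close>.\<close>

definition C_mat :: "nat \<Rightarrow> real \<Rightarrow> real \<Rightarrow> real mat" where
  "C_mat L \<alpha> \<phi> = mat L L (\<lambda>(i, j).
     if i = j then 1
     else if i = j + 1 then - \<phi>
     else if i = 0 \<and> j = L - 1 then - \<alpha> * \<phi>
     else 0)"

definition R_mat :: "nat \<Rightarrow> real \<Rightarrow> real \<Rightarrow> real mat" where
  "R_mat L \<alpha> \<phi> = mat (2 * L) (2 * L) (\<lambda>(i, j).
     if i = 0 \<and> j = L - 1 then \<alpha> * \<phi>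
     else if i = 2 * L - 1 \<and> j = L - 1 then - 1
     else if i = 2 * L - 1 \<and> j = L then \<alpha> * \<phi>
     else 0)"

definition block_mat :: "nat \<Rightarrow> real \<Rightarrow> real \<Rightarrow> real \<Rightarrow> real mat" where
  "block_mat L \<alpha> \<phi> \<psi> = four_block_mat
     (C_mat L \<alpha> \<phi>)  (\<psi> \<cdot>\<^sub>m 1\<^sub>m L)
     (0\<^sub>m L L)        (transpose_mat (C_mat L \<alpha> \<phi>))"

text \<open>Meaningful only if \<open>block_mat L \<alpha> \<phi> \<psi>\<close> is invertible.\<close>

definition M_mat :: "nat \<Rightarrow> real \<Rightarrow> real \<Rightarrow> real \<Rightarrow> real mat" where
  "M_mat L \<alpha> \<phi> \<psi> = the (mat_inverse (block_mat L \<alpha> \<phi> \<psi>)) * R_mat L \<alpha> \<phi>"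

definition M_red :: "nat \<Rightarrow> real \<Rightarrow> real \<Rightarrow> real \<Rightarrow> real mat" where
  "M_red L \<alpha> \<phi> \<psi> = mat_of_rows_list 2
     [[\<alpha> * \<phi> ^ L / (1 - \<alpha> * \<phi> ^ L)
         + \<psi> / (1 - \<alpha> * \<phi> ^ L)\<^sup>2 * ((1 - \<phi> ^ (2 * L)) / (1 - \<phi>\<^sup>2)),
       - (\<alpha> * \<phi> * \<psi> / (1 - \<alpha> * \<phi> ^ L)\<^sup>2 * ((1 - \<phi> ^ (2 * L)) / (1 - \<phi>\<^sup>2)))],
      [- (\<phi> ^ (L - 1) / (1 - \<alpha> * \<phi> ^ L)),
       \<alpha> * \<phi> ^ L / (1 - \<alpha> * \<phi> ^ L)]]"

text \<open>The complex eigenvalues of a real square matrix, each occurring as often as its algebraic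
  multiplicity.\<close>

definition eigenvalues_mset :: "real mat \<Rightarrow> complex multiset" where
  "eigenvalues_mset A = proots (char_poly (map_mat complex_of_real A))"

lemma count_eigenvalues_mset:
  assumes "A \<in> carrier_mat n n"
  shows "count (eigenvalues_mset A) z = order z (char_poly (map_mat complex_of_real A))"
proof -
  have "map_mat complex_of_real A \<in> carrier_mat n n" using assms by simp
  then have "char_poly (map_mat complex_of_real A) \<noteq> 0"
    by (metis degree_monic_char_poly leading_coeff_0_iff zero_neq_one)
  then show ?thesis by (simp add: eigenvalues_mset_def)
qed

lemma set_eigenvalues_mset:
  assumes "A \<in> carrier_mat n n"
  shows "z \<in># eigenvalues_mset A \<longleftrightarrow> eigenvalue (map_mat complex_of_real A) z"
proof -
  have car: "map_mat complex_of_real A \<in> carrier_mat n n" using assms by simp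
  then have "char_poly (map_mat complex_of_real A) \<noteq> 0"
    by (metis degree_monic_char_poly leading_coeff_0_iff zero_neq_one)
  then show ?thesis
    by (simp add: eigenvalues_mset_def eigenvalue_root_char_poly[OF car])
qed

end

theory Submission
  imports Defs "HOL-Computational_Algebra.Fundamental_Theorem_Algebra"
begin

text \<open>
  Only the columns \<open>L - 1\<close> and \<open>L\<close> of \<open>R\<close>, and hence of \<open>M\<close>, can be non-zero. The characteristic
  polynomial of such a matrix is a power of the variable times the characteristic polynomial of
  the submatrix with those rows and columns (\<open>char_poly_zero_columns_outside\<close>), so it remains to see
  that this submatrix of \<open>M\<close> is \<open>M_red\<close>.

  The two columns solve \<open>C x + \<psi> z = \<gamma> e\<^sub>0\<close>, \<open>C\<^sup>T z = \<beta> e\<close> with \<open>e\<close> the last unit vector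
  and scalars \<open>\<gamma>\<close>, \<open>\<beta>\<close>, and only
  the last entry of \<open>x\<close> and the first of \<open>z\<close> are wanted. If \<open>y\<close> is the last row of \<open>C\<inverse>\<close>, that is
  \<open>C\<^sup>T y = e\<close>, then \<open>z = \<beta> y\<close>, and pairing the first equation with \<open>y\<close> gives the last entry
  of \<open>x\<close> as \<open>\<gamma> y\<^sub>0 - \<psi> \<beta> (y \<bullet> y)\<close>. The entries of \<open>y\<close> are
  the descending powers of \<open>\<phi>\<close> divided by \<open>1 - \<alpha> \<phi>\<^sup>L\<close>, so \<open>y \<bullet> y\<close> is a geometric sum in \<open>\<phi>\<^sup>2\<close>, which is the
  source of the fraction with \<open>1 - \<phi>\<^sup>2\<close> in \<open>M_red\<close> (\<open>block_mat_solution\<close>).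

  The limits follow from trace and characteristic polynomial of \<open>M_red\<close>. Let \<open>s\<close> be the claimed limit of \<open>\<omega>\<^sub>1\<close>,
  and at each \<open>\<alpha>\<close> let \<open>\<omega>\<^sub>1\<close> be the eigenvalue nearer to \<open>s\<close>. The value of the characteristic polynomial
  of \<open>M_red\<close> at \<open>s\<close> is \<open>(s - \<omega>\<^sub>1) (s - \<omega>\<^sub>2)\<close>; it tends to zero, and it bounds \<open>\<bar>s - \<omega>\<^sub>1\<bar>\<^sup>2\<close>. The trace
  tends to \<open>s\<close>, which leaves zero for \<open>\<omega>\<^sub>2\<close> (\<open>ordered_pair_limits\<close>).
\<close>

section \<open>Characteristic polynomials of matrices with zero columns\<close>

text \<open>With its leading columns zero, the matrix is block upper triangular, and so is the matrix whose
  determinant defines the characteristic polynomial.\<close>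

lemma char_poly_leading_zero_columns:
  fixes A :: "'a :: idom mat"
  assumes A: "A \<in> carrier_mat (m + k) (m + k)"
    and zero: "\<And>i j. i < m + k \<Longrightarrow> j < m \<Longrightarrow> A $$ (i, j) = 0"
  shows "char_poly A = [:0, 1:] ^ m * char_poly (mat k k (\<lambda>(i, j). A $$ (m + i, m + j)))"
proof -
  let ?B = "mat k k (\<lambda>(i, j). A $$ (m + i, m + j))"
  let ?U = "mat m k (\<lambda>(i, j). [:- A $$ (i, m + j):])"
  have "char_poly_matrix A
      = four_block_mat ([:0, 1:] \<cdot>\<^sub>m 1\<^sub>m m) ?U (0\<^sub>m k m) (char_poly_matrix ?B)"
    using A by (intro eq_matI) (auto simp: char_poly_matrix_def zero)
  also have "det \<dots> = det ([:0, 1:] \<cdot>\<^sub>m 1\<^sub>m m) * det (char_poly_matrix ?B)"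
    by (rule det_four_block_mat_lower_left_zero) auto
  finally show ?thesis
    by (simp add: char_poly_def)
qed

lemma char_poly_trailing_zero_columns:
  fixes A :: "'a :: idom mat"
  assumes A: "A \<in> carrier_mat (k + m) (k + m)"
    and zero: "\<And>i j. i < k + m \<Longrightarrow> k \<le> j \<Longrightarrow> j < k + m \<Longrightarrow> A $$ (i, j) = 0"
  shows "char_poly A = [:0, 1:] ^ m * char_poly (mat k k (\<lambda>(i, j). A $$ (i, j)))"
proof -
  let ?B = "mat k k (\<lambda>(i, j). A $$ (i, j))"
  let ?V = "mat m k (\<lambda>(i, j). [:- A $$ (k + i, j):])"
  have "char_poly_matrix A
      = four_block_mat (char_poly_matrix ?B) (0\<^sub>m k m) ?V ([:0, 1:] \<cdot>\<^sub>m 1\<^sub>m m)"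
    using A by (intro eq_matI) (auto simp: char_poly_matrix_def zero)
  also have "det \<dots> = det (char_poly_matrix ?B) * det ([:0, 1:] \<cdot>\<^sub>m 1\<^sub>m m)"
    by (rule det_four_block_mat_upper_right_zero) auto
  finally show ?thesis
    by (simp add: char_poly_def mult.commute)
qed

lemma char_poly_zero_columns_outside:
  fixes A :: "'a :: idom mat"
  assumes A: "A \<in> carrier_mat (m + k + n) (m + k + n)"
    and zero: "\<And>i j. i < m + k + n \<Longrightarrow> j < m + k + n \<Longrightarrow> j < m \<or> m + k \<le> j \<Longrightarrow> A $$ (i, j) = 0"
  shows "char_poly A = [:0, 1:] ^ (m + n) * char_poly (mat k k (\<lambda>(i, j). A $$ (m + i, m + j)))"
proof -
  let ?B = "mat (m + k) (m + k) (\<lambda>(i, j). A $$ (i, j))"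
  let ?D = "mat k k (\<lambda>(i, j). ?B $$ (m + i, m + j))"
  have "char_poly A = [:0, 1:] ^ n * char_poly ?B"
    by (rule char_poly_trailing_zero_columns[OF A]) (use zero in auto)
  also have "char_poly ?B = [:0, 1:] ^ m * char_poly ?D"
    by (rule char_poly_leading_zero_columns) (use zero in auto)
  also have "?D = mat k k (\<lambda>(i, j). A $$ (m + i, m + j))"
    by (intro eq_matI) auto
  finally show ?thesis
    by (simp add: power_add mult_ac)
qed

lemma eigenvalues_mset_zero_columns_outside:
  assumes A: "A \<in> carrier_mat (m + k + n) (m + k + n)"
    and zero: "\<And>i j. i < m + k + n \<Longrightarrow> j < m + k + n \<Longrightarrow> j < m \<or> m + k \<le> j \<Longrightarrow> A $$ (i, j) = 0"
  shows "eigenvalues_mset A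
    = eigenvalues_mset (mat k k (\<lambda>(i, j). A $$ (m + i, m + j))) + replicate_mset (m + n) 0"
proof -
  let ?cA = "map_mat complex_of_real A"
  let ?B = "mat k k (\<lambda>(i, j). A $$ (m + i, m + j))"
  have "char_poly ?cA = [:0, 1:] ^ (m + n) * char_poly (mat k k (\<lambda>(i, j). ?cA $$ (m + i, m + j)))"
    by (rule char_poly_zero_columns_outside) (use A zero in auto)
  also have "mat k k (\<lambda>(i, j). ?cA $$ (m + i, m + j)) = map_mat complex_of_real ?B"
    using A by (intro eq_matI) auto
  finally have eq: "char_poly ?cA = [:0, 1:] ^ (m + n) * char_poly (map_mat complex_of_real ?B)" .
  have nz: "char_poly (map_mat complex_of_real ?B) \<noteq> 0"
    using degree_monic_char_poly[of "map_mat complex_of_real ?B" k] by auto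
  have "proots ([:0, 1:] ^ (m + n) :: complex poly) = replicate_mset (m + n) 0"
    by (simp add: proots_power)
  then show ?thesis
    unfolding eigenvalues_mset_def eq by (subst proots_mult) (use nz in auto)
qed

section \<open>Eigenvalues of two-by-two matrices\<close>

lemma det_2x2:
  fixes A :: "'a :: comm_ring_1 mat"
  assumes "A \<in> carrier_mat 2 2"
  shows "det A = A $$ (0, 0) * A $$ (1, 1) - A $$ (0, 1) * A $$ (1, 0)"
proof -
  have "det A = (\<Sum>i<2. A $$ (i, 0) * cofactor A i 0)"
    using laplace_expansion_column[OF assms, of 0] by simp
  moreover have "det (mat_delete A i 0) = A $$ (1 - i, 1)" if "i < 2" for i
    using assms that by (subst det_single) (auto simp: mat_delete_def)
  ultimately show ?thesis
    by (simp add: cofactor_def numeral_2_eq_2)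
qed

lemma eigenvalues_mset_2x2:
  assumes A: "A \<in> carrier_mat 2 2"
  obtains a b where "eigenvalues_mset A = {#a, b#}"
proof -
  let ?p = "char_poly (map_mat complex_of_real A)"
  have "degree ?p = 2"
    using degree_monic_char_poly[of "map_mat complex_of_real A" 2] A by auto
  then have "size (eigenvalues_mset A) = 2"
    by (simp add: eigenvalues_mset_def size_proots_complex)
  then show ?thesis
    using that by (metis numeral_2_eq_2 size_eq_Suc_imp_eq_union nat.inject size_add_mset size_eq_0_iff_empty)
qed

text \<open>Both sides are the characteristic polynomial at \<open>x\<close>, once as a product over its roots and once as a
  determinant. Comparing coefficients of \<open>x\<close> then gives the trace.\<close>

lemma eigenvalues_mset_2x2_char_poly:
  assumes A: "A \<in> carrier_mat 2 2" and ev: "eigenvalues_mset A = {#a, b#}"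
  shows "(x - a) * (x - b)
    = (x - of_real (A $$ (0, 0))) * (x - of_real (A $$ (1, 1)))
      - of_real (A $$ (0, 1)) * of_real (A $$ (1, 0))"
proof -
  let ?cA = "map_mat complex_of_real A"
  let ?p = "char_poly ?cA"
  have cA: "?cA \<in> carrier_mat 2 2" using A by simp
  have "proots ?p = {#a, b#}" and "lead_coeff ?p = 1"
    using ev degree_monic_char_poly[OF cA] by (auto simp: eigenvalues_mset_def)
  then have "?p = [:- a, 1:] * [:- b, 1:]"
    using complex_poly_decompose_multiset[of ?p] by simp
  then have "(x - a) * (x - b) = poly ?p x" by (simp add: algebra_simps)
  also have "\<dots> = poly (char_poly_matrix ?cA $$ (0, 0) * char_poly_matrix ?cA $$ (1, 1)
      - char_poly_matrix ?cA $$ (0, 1) * char_poly_matrix ?cA $$ (1, 0)) x"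
    unfolding char_poly_def using cA by (subst det_2x2) auto
  also have "\<dots> = (x - of_real (A $$ (0, 0))) * (x - of_real (A $$ (1, 1)))
      - of_real (A $$ (0, 1)) * of_real (A $$ (1, 0))"
    using A by (simp add: char_poly_matrix_def algebra_simps)
  finally show ?thesis .
qed

lemma eigenvalues_mset_2x2_trace:
  assumes A: "A \<in> carrier_mat 2 2" and ev: "eigenvalues_mset A = {#a, b#}"
  shows "a + b = of_real (A $$ (0, 0)) + of_real (A $$ (1, 1))"
  using eigenvalues_mset_2x2_char_poly[OF A ev, of 0] eigenvalues_mset_2x2_char_poly[OF A ev, of 1]
  by (simp add: algebra_simps)

text \<open>The nearer of two points has distance at most the geometric mean of both distances from
  \<open>s\<close>.\<close>

lemma ordered_pair_limits:
  fixes a b :: "'x \<Rightarrow> 'a :: real_normed_field"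
  assumes prod: "((\<lambda>x. (s - a x) * (s - b x)) \<longlongrightarrow> 0) F"
    and sum: "((\<lambda>x. a x + b x) \<longlongrightarrow> s) F"
    and le: "\<And>x. norm (s - a x) \<le> norm (s - b x)"
  shows "(a \<longlongrightarrow> s) F" and "(b \<longlongrightarrow> 0) F"
proof -
  have "((\<lambda>x. sqrt (norm ((s - a x) * (s - b x)))) \<longlongrightarrow> 0) F"
    using tendsto_real_sqrt[OF tendsto_norm_zero[OF prod]] by simp
  moreover have "norm (s - a x) \<le> sqrt (norm ((s - a x) * (s - b x)))" for x
    using le[of x] by (intro real_le_rsqrt) (simp add: norm_mult power2_eq_square mult_left_mono)
  ultimately have "((\<lambda>x. norm (s - a x)) \<longlongrightarrow> 0) F"
    by (intro real_tendsto_sandwich[of "\<lambda>_. 0" "\<lambda>x. norm (s - a x)" F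
          "\<lambda>x. sqrt (norm ((s - a x) * (s - b x)))"]) auto
  then have "((\<lambda>x. s - a x) \<longlongrightarrow> 0) F"
    by (rule tendsto_norm_zero_cancel)
  from tendsto_diff[OF tendsto_const[of s] this] show a: "(a \<longlongrightarrow> s) F" by simp
  from tendsto_diff[OF sum a] show "(b \<longlongrightarrow> 0) F" by simp
qed

section \<open>The cyclic bidiagonal matrix\<close>

text \<open>For \<open>\<alpha> \<phi>\<^sup>L \<noteq> 1\<close> this is the solution of \<open>C\<^sup>T y = e\<close> with \<open>e\<close> the last unit vector. A row of
  \<open>C\<inverse>\<close> in closed form lets one read off an entry of a solution of \<open>C x = b\<close> as a scalar
  product with \<open>b\<close>.\<close>

definition C_inv_last_row :: "nat \<Rightarrow> real \<Rightarrow> real \<Rightarrow> real vec" where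
  "C_inv_last_row L \<alpha> \<phi> = vec L (\<lambda>i. \<phi> ^ (L - 1 - i) / (1 - \<alpha> * \<phi> ^ L))"

lemma C_mat_carrier [simp]: "C_mat L \<alpha> \<phi> \<in> carrier_mat L L"
  by (simp add: C_mat_def)

lemma C_mat_mult_vec:
  assumes L: "L \<ge> 2" and x: "x \<in> carrier_vec L" and i: "i < L"
  shows "(C_mat L \<alpha> \<phi> *\<^sub>v x) $ i
    = x $ i - (if i = 0 then \<alpha> * \<phi> * x $ (L - 1) else \<phi> * x $ (i - 1))"
proof -
  \<comment> \<open>the column of the only off-diagonal entry of row \<open>i\<close>, and minus that entry\<close>
  define i' where "i' = (if i = 0 then L - 1 else i - 1)"
  define c where "c = (if i = 0 then \<alpha> * \<phi> else \<phi>)"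
  have "(C_mat L \<alpha> \<phi> *\<^sub>v x) $ i = (\<Sum>k\<in>{0..<L}. C_mat L \<alpha> \<phi> $$ (i, k) * x $ k)"
    using x i by (simp add: scalar_prod_def C_mat_def)
  also have "\<dots> = (\<Sum>k\<in>{0..<L}. (if k = i then x $ k else 0) - (if k = i' then c * x $ k else 0))"
    using L i by (intro sum.cong) (auto simp: C_mat_def i'_def c_def)
  also have "\<dots> = x $ i - c * x $ i'"
    using L i by (auto simp: sum_subtractf i'_def)
  finally show ?thesis by (simp add: i'_def c_def)
qed

lemma C_mat_transpose_mult_vec:
  assumes L: "L \<ge> 2" and x: "x \<in> carrier_vec L" and i: "i < L"
  shows "((C_mat L \<alpha> \<phi>)\<^sup>T *\<^sub>v x) $ i
    = x $ i - (if i = L - 1 then \<alpha> * \<phi> * x $ 0 else \<phi> * x $ (i + 1))"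
proof -
  \<comment> \<open>the row of the only off-diagonal entry of column \<open>i\<close>, and minus that entry\<close>
  define i' where "i' = (if i = L - 1 then 0 else i + 1)"
  define c where "c = (if i = L - 1 then \<alpha> * \<phi> else \<phi>)"
  have "((C_mat L \<alpha> \<phi>)\<^sup>T *\<^sub>v x) $ i = (\<Sum>k\<in>{0..<L}. C_mat L \<alpha> \<phi> $$ (k, i) * x $ k)"
    using x i by (simp add: scalar_prod_def C_mat_def)
  also have "\<dots> = (\<Sum>k\<in>{0..<L}. (if k = i then x $ k else 0) - (if k = i' then c * x $ k else 0))"
    using L i by (intro sum.cong) (auto simp: C_mat_def i'_def c_def)
  also have "\<dots> = x $ i - c * x $ i'"
    using L i by (auto simp: sum_subtractf i'_def)
  finally show ?thesis by (simp add: i'_def c_def)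
qed

lemma C_mat_transpose_mult_C_inv_last_row:
  assumes L: "L \<ge> 2" and d: "\<alpha> * \<phi> ^ L \<noteq> 1"
  shows "(C_mat L \<alpha> \<phi>)\<^sup>T *\<^sub>v C_inv_last_row L \<alpha> \<phi> = unit_vec L (L - 1)"
proof (rule eq_vecI)
  fix i assume "i < dim_vec (unit_vec L (L - 1) :: real vec)"
  then have i: "i < L" by simp
  have pow: "\<phi> * \<phi> ^ (L - 1) = \<phi> ^ L" using L by (simp flip: power_Suc)
  have pow': "\<phi> * \<phi> ^ (L - 1 - (i + 1)) = \<phi> ^ (L - 1 - i)" if "i \<noteq> L - 1"
    using that i by (subst power_Suc[symmetric], intro arg_cong[where f = "\<lambda>n. \<phi> ^ n"]) simp
  have car: "C_inv_last_row L \<alpha> \<phi> \<in> carrier_vec L" by (simp add: C_inv_last_row_def)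
  show "((C_mat L \<alpha> \<phi>)\<^sup>T *\<^sub>v C_inv_last_row L \<alpha> \<phi>) $ i = unit_vec L (L - 1) $ i"
    unfolding C_mat_transpose_mult_vec[OF L car i]
    using L i d pow pow'
    by (auto simp: C_inv_last_row_def mult.assoc diff_divide_distrib [symmetric])
qed (simp add: C_mat_def)

text \<open>A kernel vector is geometric with ratio \<open>\<phi>\<close>; going once around the cycle multiplies its first entry
  by \<open>\<alpha> \<phi>\<^sup>L\<close>, so that entry vanishes.\<close>

lemma det_C_mat_nonzero:
  assumes L: "L \<ge> 2" and d: "\<alpha> * \<phi> ^ L \<noteq> 1"
  shows "det (C_mat L \<alpha> \<phi>) \<noteq> 0"
proof
  assume "det (C_mat L \<alpha> \<phi>) = 0"
  then obtain x where x: "x \<in> carrier_vec L" "x \<noteq> 0\<^sub>v L" "C_mat L \<alpha> \<phi> *\<^sub>v x = 0\<^sub>v L"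
    using det_0_iff_vec_prod_zero[OF C_mat_carrier] by blast
  have rec: "x $ i = (if i = 0 then \<alpha> * \<phi> * x $ (L - 1) else \<phi> * x $ (i - 1))" if "i < L" for i
    using C_mat_mult_vec[OF L x(1) that, of \<alpha> \<phi>] x(3) that by simp
  have geo: "x $ i = \<phi> ^ i * x $ 0" if "i < L" for i
    using that by (induction i) (use rec in auto)
  have "x $ 0 = \<alpha> * \<phi> * x $ (L - 1)"
    using rec[of 0] L by simp
  also have "\<dots> = \<alpha> * (\<phi> * \<phi> ^ (L - 1)) * x $ 0"
    using geo[of "L - 1"] L by (simp only: mult_ac)
  also have "\<phi> * \<phi> ^ (L - 1) = \<phi> ^ L" using L by (simp flip: power_Suc)
  finally have "x $ 0 = 0" using d by auto
  then have "x = 0\<^sub>v L" using x(1) geo by (intro eq_vecI) auto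
  with x(2) show False by simp
qed

lemma C_inv_last_row_norm_square:
  assumes "\<phi> \<noteq> 1" and "\<phi> \<noteq> - 1"
  shows "C_inv_last_row L \<alpha> \<phi> \<bullet> C_inv_last_row L \<alpha> \<phi>
    = (1 - \<phi> ^ (2 * L)) / (1 - \<phi>\<^sup>2) / (1 - \<alpha> * \<phi> ^ L)\<^sup>2"
proof -
  let ?d = "1 - \<alpha> * \<phi> ^ L"
  have ne: "\<phi>\<^sup>2 \<noteq> 1" using assms by (simp add: power2_eq_1_iff)
  have "C_inv_last_row L \<alpha> \<phi> \<bullet> C_inv_last_row L \<alpha> \<phi> = (\<Sum>i<L. (\<phi>\<^sup>2) ^ (L - Suc i)) / ?d\<^sup>2"
    unfolding sum_divide_distrib scalar_prod_def
    by (intro sum.cong)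
      (auto simp: C_inv_last_row_def power2_eq_square power_mult_distrib)
  also have "(\<Sum>i<L. (\<phi>\<^sup>2) ^ (L - Suc i)) = (\<Sum>i<L. (\<phi>\<^sup>2) ^ i)"
    by (rule sum.nat_diff_reindex)
  also have "\<dots> = (1 - \<phi> ^ (2 * L)) / (1 - \<phi>\<^sup>2)"
    using ne by (simp add: sum_gp_strict power_mult)
  finally show ?thesis .
qed

section \<open>The block matrix and its reduction\<close>

lemma block_mat_carrier [simp]: "block_mat L \<alpha> \<phi> \<psi> \<in> carrier_mat (2 * L) (2 * L)"
  using four_block_carrier_mat[of "C_mat L \<alpha> \<phi>" L L "(C_mat L \<alpha> \<phi>)\<^sup>T" L L]
  by (simp add: block_mat_def mult_2)

lemma R_mat_carrier [simp]: "R_mat L \<alpha> \<phi> \<in> carrier_mat (2 * L) (2 * L)"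
  by (simp add: R_mat_def)

lemma block_mat_inverse:
  assumes L: "L \<ge> 2" and d: "\<alpha> * \<phi> ^ L \<noteq> 1"
  obtains B where "mat_inverse (block_mat L \<alpha> \<phi> \<psi>) = Some B"
    and "block_mat L \<alpha> \<phi> \<psi> * B = 1\<^sub>m (2 * L)" and "B * block_mat L \<alpha> \<phi> \<psi> = 1\<^sub>m (2 * L)"
    and "B \<in> carrier_mat (2 * L) (2 * L)"
proof -
  have "det (block_mat L \<alpha> \<phi> \<psi>) = det (C_mat L \<alpha> \<phi>) * det ((C_mat L \<alpha> \<phi>)\<^sup>T)"
    unfolding block_mat_def by (rule det_four_block_mat_lower_left_zero) auto
  also have "\<dots> \<noteq> 0"
    using det_C_mat_nonzero[OF L d] by (simp add: det_transpose[OF C_mat_carrier])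
  finally have "block_mat L \<alpha> \<phi> \<psi> \<in> Units (ring_mat TYPE(real) (2 * L) ())"
    by (intro det_non_zero_imp_unit[OF block_mat_carrier])
  then have "mat_inverse (block_mat L \<alpha> \<phi> \<psi>) \<noteq> None"
    using mat_inverse(1)[OF block_mat_carrier, where b = "()"] by blast
  then obtain B where B: "mat_inverse (block_mat L \<alpha> \<phi> \<psi>) = Some B"
    by blast
  with mat_inverse(2)[OF block_mat_carrier B] that show ?thesis by blast
qed

text \<open>The right-hand side has the shape of every column of \<open>R\<close>. The lower half of the system determines
  \<open>z\<close> as a multiple of the last row \<open>y\<close> of \<open>C\<inverse>\<close>; by adjointness the last entry of \<open>x\<close> is
  \<open>C\<^sup>T y \<bullet> x = y \<bullet> C x\<close>, and \<open>C x\<close> is known from the upper half.\<close>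

lemma block_mat_solution:
  assumes L: "L \<ge> 2" and d: "\<alpha> * \<phi> ^ L \<noteq> 1" and \<phi>: "\<phi> \<noteq> 1" "\<phi> \<noteq> - 1"
    and v: "v \<in> carrier_vec (2 * L)"
    and eq: "block_mat L \<alpha> \<phi> \<psi> *\<^sub>v v = (\<gamma> \<cdot>\<^sub>v unit_vec L 0) @\<^sub>v (\<beta> \<cdot>\<^sub>v unit_vec L (L - 1))"
  shows "v $ (L - 1) = \<gamma> * (\<phi> ^ (L - 1) / (1 - \<alpha> * \<phi> ^ L))
      - \<psi> * \<beta> * ((1 - \<phi> ^ (2 * L)) / (1 - \<phi>\<^sup>2) / (1 - \<alpha> * \<phi> ^ L)\<^sup>2)"
    and "v $ L = \<beta> * (\<phi> ^ (L - 1) / (1 - \<alpha> * \<phi> ^ L))"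
proof -
  let ?C = "C_mat L \<alpha> \<phi>" and ?y = "C_inv_last_row L \<alpha> \<phi>"
  define x z where "x = vec_first v L" and "z = vec_last v L"
  have xz: "x \<in> carrier_vec L" "z \<in> carrier_vec L" "v = x @\<^sub>v z"
    using v vec_first_last_append[of v L L] by (auto simp: x_def z_def mult_2)
  have y: "?y \<in> carrier_vec L" by (simp add: C_inv_last_row_def)
  have "block_mat L \<alpha> \<phi> \<psi> *\<^sub>v v
      = (?C *\<^sub>v x + (\<psi> \<cdot>\<^sub>m 1\<^sub>m L) *\<^sub>v z) @\<^sub>v (0\<^sub>m L L *\<^sub>v x + ?C\<^sup>T *\<^sub>v z)"
    unfolding block_mat_def xz(3) by (rule four_block_mat_mult_vec) (use xz in auto)
  also have "\<dots> = (?C *\<^sub>v x + \<psi> \<cdot>\<^sub>v z) @\<^sub>v (?C\<^sup>T *\<^sub>v z)"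
  proof -
    have "(\<psi> \<cdot>\<^sub>m 1\<^sub>m L) *\<^sub>v z = \<psi> \<cdot>\<^sub>v z" and "0\<^sub>m L L *\<^sub>v x + ?C\<^sup>T *\<^sub>v z = ?C\<^sup>T *\<^sub>v z"
      using xz by (auto intro!: eq_vecI simp: C_mat_def)
    then show ?thesis by simp
  qed
  finally have "(?C *\<^sub>v x + \<psi> \<cdot>\<^sub>v z) @\<^sub>v (?C\<^sup>T *\<^sub>v z)
      = (\<gamma> \<cdot>\<^sub>v unit_vec L 0) @\<^sub>v (\<beta> \<cdot>\<^sub>v unit_vec L (L - 1))"
    using eq by simp
  moreover have "?C *\<^sub>v x + \<psi> \<cdot>\<^sub>v z \<in> carrier_vec L"
    using xz by (intro add_carrier_vec mult_mat_vec_carrier[OF C_mat_carrier]) auto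
  ultimately have sys: "?C *\<^sub>v x + \<psi> \<cdot>\<^sub>v z = \<gamma> \<cdot>\<^sub>v unit_vec L 0"
      "?C\<^sup>T *\<^sub>v z = \<beta> \<cdot>\<^sub>v unit_vec L (L - 1)"
    using append_vec_eq[of "?C *\<^sub>v x + \<psi> \<cdot>\<^sub>v z" L "\<gamma> \<cdot>\<^sub>v unit_vec L 0"] by auto
  have z: "z = \<beta> \<cdot>\<^sub>v ?y"
  proof -
    have "?C\<^sup>T *\<^sub>v (z - \<beta> \<cdot>\<^sub>v ?y) = 0\<^sub>v L"
    proof -
      have CT: "?C\<^sup>T \<in> carrier_mat L L" by simp
      have "?C\<^sup>T *\<^sub>v (z - \<beta> \<cdot>\<^sub>v ?y) = ?C\<^sup>T *\<^sub>v z - \<beta> \<cdot>\<^sub>v (?C\<^sup>T *\<^sub>v ?y)"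
        using mult_minus_distrib_mat_vec[OF CT xz(2), of "\<beta> \<cdot>\<^sub>v ?y"] mult_mat_vec[OF CT y] y by simp
      then show ?thesis
        by (simp add: sys(2) C_mat_transpose_mult_C_inv_last_row[OF L d])
    qed
    moreover have "det (?C\<^sup>T) \<noteq> 0"
      using det_C_mat_nonzero[OF L d] by (simp add: det_transpose[OF C_mat_carrier])
    ultimately have "z - \<beta> \<cdot>\<^sub>v ?y = 0\<^sub>v L"
      using det_0_iff_vec_prod_zero[of "?C\<^sup>T" L] xz(2) y
      by (metis C_mat_carrier transpose_carrier_mat minus_carrier_vec smult_carrier_vec)
    show ?thesis
    proof (rule eq_vecI)
      fix i assume "i < dim_vec (\<beta> \<cdot>\<^sub>v ?y)"
      then have "i < L" using y by simp
      then show "z $ i = (\<beta> \<cdot>\<^sub>v ?y) $ i"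
        using arg_cong[OF \<open>z - \<beta> \<cdot>\<^sub>v ?y = 0\<^sub>v L\<close>, of "\<lambda>w. w $ i"] xz y by simp
    qed (use xz y in simp)
  qed
  have y0: "?y $ 0 = \<phi> ^ (L - 1) / (1 - \<alpha> * \<phi> ^ L)"
    using L by (simp add: C_inv_last_row_def)
  show "v $ L = \<beta> * (\<phi> ^ (L - 1) / (1 - \<alpha> * \<phi> ^ L))"
    using xz y L y0 by (simp add: z)
  have "x $ (L - 1) = unit_vec L (L - 1) \<bullet> x"
    using xz L by simp
  also have "\<dots> = ?y \<bullet> (?C *\<^sub>v x)"
    using transpose_vec_mult_scalar[OF C_mat_carrier xz(1) y, of \<alpha> \<phi>]
    by (simp only: C_mat_transpose_mult_C_inv_last_row[OF L d])
  also have "?C *\<^sub>v x = \<gamma> \<cdot>\<^sub>v unit_vec L 0 - \<psi> \<cdot>\<^sub>v z"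
  proof (rule eq_vecI)
    fix i assume "i < dim_vec (\<gamma> \<cdot>\<^sub>v unit_vec L 0 - \<psi> \<cdot>\<^sub>v z)"
    then show "(?C *\<^sub>v x) $ i = (\<gamma> \<cdot>\<^sub>v unit_vec L 0 - \<psi> \<cdot>\<^sub>v z) $ i"
      using arg_cong[OF sys(1), of "\<lambda>w. w $ i"] xz by (simp add: algebra_simps)
  qed (use xz in \<open>simp add: C_mat_def\<close>)
  also have "?y \<bullet> \<dots> = \<gamma> * ?y $ 0 - \<psi> * \<beta> * (?y \<bullet> ?y)"
    using y L by (simp add: z scalar_prod_minus_distrib[of _ L])
  finally show "v $ (L - 1) = \<gamma> * (\<phi> ^ (L - 1) / (1 - \<alpha> * \<phi> ^ L))
      - \<psi> * \<beta> * ((1 - \<phi> ^ (2 * L)) / (1 - \<phi>\<^sup>2) / (1 - \<alpha> * \<phi> ^ L)\<^sup>2)"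
    using xz L y0 C_inv_last_row_norm_square[OF \<phi>, of L \<alpha>] by simp
qed

lemma R_mat_col:
  assumes L: "L \<ge> 2" and j: "j < 2 * L"
  shows "col (R_mat L \<alpha> \<phi>) j
    = ((if j = L - 1 then \<alpha> * \<phi> else 0) \<cdot>\<^sub>v unit_vec L 0)
      @\<^sub>v ((if j = L - 1 then - 1 else if j = L then \<alpha> * \<phi> else 0) \<cdot>\<^sub>v unit_vec L (L - 1))"
  by (rule eq_vecI) (use L j in \<open>auto simp: R_mat_def\<close>)

lemma M_red_carrier [simp]: "M_red L \<alpha> \<phi> \<psi> \<in> carrier_mat 2 2"
  by (rule carrier_matI) (simp_all add: M_red_def mat_of_rows_list_def)

lemma M_red_entries:
  "M_red L \<alpha> \<phi> \<psi> $$ (0, 0) = \<alpha> * \<phi> ^ L / (1 - \<alpha> * \<phi> ^ L)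
     + \<psi> / (1 - \<alpha> * \<phi> ^ L)\<^sup>2 * ((1 - \<phi> ^ (2 * L)) / (1 - \<phi>\<^sup>2))"
  "M_red L \<alpha> \<phi> \<psi> $$ (0, 1)
     = - (\<alpha> * \<phi> * \<psi> / (1 - \<alpha> * \<phi> ^ L)\<^sup>2 * ((1 - \<phi> ^ (2 * L)) / (1 - \<phi>\<^sup>2)))"
  "M_red L \<alpha> \<phi> \<psi> $$ (1, 0) = - (\<phi> ^ (L - 1) / (1 - \<alpha> * \<phi> ^ L))"
  "M_red L \<alpha> \<phi> \<psi> $$ (1, 1) = \<alpha> * \<phi> ^ L / (1 - \<alpha> * \<phi> ^ L)"
  by (simp_all add: M_red_def mat_of_rows_list_def)

text \<open>Column \<open>j\<close> of \<open>M\<close> solves the block system with column \<open>j\<close> of \<open>R\<close> as right-hand side, so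
  \<open>M_red\<close> comes from \<open>block_mat_solution\<close> with \<open>(\<gamma>, \<beta>) = (\<alpha> \<phi>, - 1)\<close> for its first column and
  \<open>(0, \<alpha> \<phi>)\<close> for its second.\<close>

lemma M_mat_columns:
  assumes L: "L \<ge> 2" and d: "\<alpha> * \<phi> ^ L \<noteq> 1" and \<phi>: "\<phi> \<noteq> 1" "\<phi> \<noteq> - 1"
  shows "M_mat L \<alpha> \<phi> \<psi> \<in> carrier_mat (2 * L) (2 * L)"
    and "\<And>i j. i < 2 * L \<Longrightarrow> j < 2 * L \<Longrightarrow> j \<noteq> L - 1 \<Longrightarrow> j \<noteq> L \<Longrightarrow> M_mat L \<alpha> \<phi> \<psi> $$ (i, j) = 0"
    and "mat 2 2 (\<lambda>(i, j). M_mat L \<alpha> \<phi> \<psi> $$ (L - 1 + i, L - 1 + j)) = M_red L \<alpha> \<phi> \<psi>"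
proof -
  let ?A = "block_mat L \<alpha> \<phi> \<psi>" and ?R = "R_mat L \<alpha> \<phi>" and ?M = "M_mat L \<alpha> \<phi> \<psi>"
  obtain B where B: "mat_inverse ?A = Some B" "?A * B = 1\<^sub>m (2 * L)" "B \<in> carrier_mat (2 * L) (2 * L)"
    using block_mat_inverse[OF L d] by blast
  have M: "?M = B * ?R" by (simp add: M_mat_def B)
  show car: "?M \<in> carrier_mat (2 * L) (2 * L)" using B by (simp add: M)
  have AM: "?A * ?M = ?R"
    unfolding M assoc_mult_mat[OF block_mat_carrier B(3) R_mat_carrier, symmetric] B(2)
    by (rule left_mult_one_mat[OF R_mat_carrier])
  show "?M $$ (i, j) = 0" if ij: "i < 2 * L" "j < 2 * L" and j: "j \<noteq> L - 1" "j \<noteq> L" for i j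
  proof -
    have "col ?R j = 0\<^sub>v (2 * L)"
      using ij j by (intro eq_vecI) (auto simp: R_mat_def)
    then show ?thesis using ij B by (simp add: M R_mat_def)
  qed
  define \<gamma> \<beta> where "\<gamma> j = (if j = L - 1 then \<alpha> * \<phi> else 0)"
    and "\<beta> j = (if j = L - 1 then - 1 else if j = L then \<alpha> * \<phi> else 0)" for j
  have col: "?A *\<^sub>v col ?M j = (\<gamma> j \<cdot>\<^sub>v unit_vec L 0) @\<^sub>v (\<beta> j \<cdot>\<^sub>v unit_vec L (L - 1))"
    if "j < 2 * L" for j
    using col_mult2[OF block_mat_carrier car that, of \<alpha> \<phi> \<psi>] R_mat_col[OF L that, of \<alpha> \<phi>]
    by (simp add: AM \<gamma>_def \<beta>_def)
  let ?d = "1 - \<alpha> * \<phi> ^ L" and ?S = "(1 - \<phi> ^ (2 * L)) / (1 - \<phi>\<^sup>2)"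
  have upper: "?M $$ (L - 1, j) = \<gamma> j * (\<phi> ^ (L - 1) / ?d) - \<psi> * \<beta> j * (?S / ?d\<^sup>2)"
    and lower: "?M $$ (L, j) = \<beta> j * (\<phi> ^ (L - 1) / ?d)" if "j < 2 * L" for j
  proof -
    have "col ?M j \<in> carrier_vec (2 * L)"
      using carrier_matD(1)[OF car] by (intro carrier_vecI) simp
    note sol = block_mat_solution[OF L d \<phi> this col[OF that]]
    show "?M $$ (L - 1, j) = \<gamma> j * (\<phi> ^ (L - 1) / ?d) - \<psi> * \<beta> j * (?S / ?d\<^sup>2)"
      "?M $$ (L, j) = \<beta> j * (\<phi> ^ (L - 1) / ?d)"
      using sol car that L by auto
  qed
  have "\<alpha> * \<phi> * (\<phi> ^ (L - 1) / ?d) = \<alpha> * (\<phi> * \<phi> ^ (L - 1)) / ?d" by simp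
  also have "\<phi> * \<phi> ^ (L - 1) = \<phi> ^ L" using L by (simp flip: power_Suc)
  finally have pow: "\<alpha> * \<phi> * (\<phi> ^ (L - 1) / ?d) = \<alpha> * \<phi> ^ L / ?d" .
  have "L - 1 < 2 * L" "L < 2 * L" "L \<noteq> L - 1" using L by auto
  then have entries: "?M $$ (L - 1, L - 1) = M_red L \<alpha> \<phi> \<psi> $$ (0, 0)"
    "?M $$ (L - 1, L) = M_red L \<alpha> \<phi> \<psi> $$ (0, 1)"
    "?M $$ (L, L - 1) = M_red L \<alpha> \<phi> \<psi> $$ (1, 0)"
    "?M $$ (L, L) = M_red L \<alpha> \<phi> \<psi> $$ (1, 1)"
    by (simp_all only: upper lower M_red_entries \<gamma>_def \<beta>_def pow if_True if_False refl)
      (simp_all add: mult_ac)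
  have suc: "L - 1 + 1 = L" using L by simp
  show "mat 2 2 (\<lambda>(i, j). ?M $$ (L - 1 + i, L - 1 + j)) = M_red L \<alpha> \<phi> \<psi>" (is "?N = _")
  proof (rule eq_matI)
    fix i j assume "i < dim_row (M_red L \<alpha> \<phi> \<psi>)" "j < dim_col (M_red L \<alpha> \<phi> \<psi>)"
    then have ij: "i < 2" "j < 2" using carrier_matD[OF M_red_carrier] by auto
    then have "?N $$ (i, j) = ?M $$ (L - 1 + i, L - 1 + j)" by simp
    moreover have "i = 0 \<or> i = 1" "j = 0 \<or> j = 1" using ij by auto
    ultimately show "?N $$ (i, j) = M_red L \<alpha> \<phi> \<psi> $$ (i, j)"
      by (elim disjE) (simp_all only: suc entries add_0_right)
  qed (simp_all only: carrier_matD[OF M_red_carrier] dim_row_mat dim_col_mat)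
qed

lemma M_red_limits:
  "((\<lambda>\<alpha>. M_red L \<alpha> \<phi> \<psi> $$ (0, 0)) \<longlongrightarrow> \<psi> * ((1 - \<phi> ^ (2 * L)) / (1 - \<phi>\<^sup>2))) (at 0)"
  "((\<lambda>\<alpha>. M_red L \<alpha> \<phi> \<psi> $$ (0, 1)) \<longlongrightarrow> 0) (at 0)"
  "((\<lambda>\<alpha>. M_red L \<alpha> \<phi> \<psi> $$ (1, 0)) \<longlongrightarrow> - (\<phi> ^ (L - 1))) (at 0)"
  "((\<lambda>\<alpha>. M_red L \<alpha> \<phi> \<psi> $$ (1, 1)) \<longlongrightarrow> 0) (at 0)"
proof -
  \<comment> \<open>constant in \<open>\<alpha>\<close>: the limit rules are to treat it as one factor, not as a quotient\<close>
  define S where "S = (1 - \<phi> ^ (2 * L)) / (1 - \<phi>\<^sup>2)"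
  show "((\<lambda>\<alpha>. M_red L \<alpha> \<phi> \<psi> $$ (0, 0)) \<longlongrightarrow> \<psi> * ((1 - \<phi> ^ (2 * L)) / (1 - \<phi>\<^sup>2))) (at 0)"
    "((\<lambda>\<alpha>. M_red L \<alpha> \<phi> \<psi> $$ (0, 1)) \<longlongrightarrow> 0) (at 0)"
    "((\<lambda>\<alpha>. M_red L \<alpha> \<phi> \<psi> $$ (1, 0)) \<longlongrightarrow> - (\<phi> ^ (L - 1))) (at 0)"
    "((\<lambda>\<alpha>. M_red L \<alpha> \<phi> \<psi> $$ (1, 1)) \<longlongrightarrow> 0) (at 0)"
    unfolding M_red_entries S_def [symmetric] by (auto intro!: tendsto_eq_intros)
qed

theorem theorem3p1:
  fixes L :: nat and \<phi> \<psi> :: real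
  assumes "L > 3" and "\<phi> \<noteq> 1" and "\<phi> \<noteq> - 1"
  shows "\<exists>\<omega>\<^sub>1 \<omega>\<^sub>2 :: real \<Rightarrow> complex.
    (\<forall>\<alpha>. \<alpha> \<noteq> 0 \<and> \<alpha> * \<phi> ^ L \<noteq> 1 \<longrightarrow>
       invertible_mat (block_mat L \<alpha> \<phi> \<psi>) \<and>
       eigenvalues_mset (M_red L \<alpha> \<phi> \<psi>) = {# \<omega>\<^sub>1 \<alpha>, \<omega>\<^sub>2 \<alpha> #} \<and>
       eigenvalues_mset (M_mat L \<alpha> \<phi> \<psi>)
         = {# \<omega>\<^sub>1 \<alpha>, \<omega>\<^sub>2 \<alpha> #} + replicate_mset (2 * L - 2) 0) \<and>
    (\<omega>\<^sub>1 \<longlongrightarrow> complex_of_real (\<psi> * ((1 - \<phi> ^ (2 * L)) / (1 - \<phi>\<^sup>2)))) (at 0) \<and>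
    (\<omega>\<^sub>2 \<longlongrightarrow> 0) (at 0)"
proof -
  have L: "L \<ge> 2" using assms(1) by simp
  define s where "s = complex_of_real (\<psi> * ((1 - \<phi> ^ (2 * L)) / (1 - \<phi>\<^sup>2)))"
  let ?N = "\<lambda>\<alpha>. M_red L \<alpha> \<phi> \<psi>"
  \<comment> \<open>The labelling: the eigenvalue nearer to the claimed limit \<open>s\<close> comes first.\<close>
  have "\<exists>a b. eigenvalues_mset (?N \<alpha>) = {#a, b#} \<and> norm (s - a) \<le> norm (s - b)" for \<alpha>
  proof -
    obtain a b where ab: "eigenvalues_mset (?N \<alpha>) = {#a, b#}"
      using eigenvalues_mset_2x2[OF M_red_carrier] by blast
    then have "eigenvalues_mset (?N \<alpha>) = {#b, a#}" by (simp add: add_mset_commute)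
    with ab show ?thesis
      by (cases "norm (s - a) \<le> norm (s - b)") (blast, meson linear)
  qed
  then obtain \<omega>\<^sub>1 \<omega>\<^sub>2 where ev: "\<And>\<alpha>. eigenvalues_mset (?N \<alpha>) = {#\<omega>\<^sub>1 \<alpha>, \<omega>\<^sub>2 \<alpha>#}"
    and le: "\<And>\<alpha>. norm (s - \<omega>\<^sub>1 \<alpha>) \<le> norm (s - \<omega>\<^sub>2 \<alpha>)"
    by metis
  have lims:
    "((\<lambda>\<alpha>. complex_of_real (?N \<alpha> $$ (0, 0))) \<longlongrightarrow> s) (at 0)"
    "((\<lambda>\<alpha>. complex_of_real (?N \<alpha> $$ (0, 1))) \<longlongrightarrow> 0) (at 0)"
    "((\<lambda>\<alpha>. complex_of_real (?N \<alpha> $$ (1, 0))) \<longlongrightarrow> of_real (- (\<phi> ^ (L - 1)))) (at 0)"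
    "((\<lambda>\<alpha>. complex_of_real (?N \<alpha> $$ (1, 1))) \<longlongrightarrow> 0) (at 0)"
    using M_red_limits[of L \<phi> \<psi>, THEN tendsto_of_real, where ?'a = complex]
    by (simp_all add: s_def)
  have "((\<lambda>\<alpha>. (s - \<omega>\<^sub>1 \<alpha>) * (s - \<omega>\<^sub>2 \<alpha>)) \<longlongrightarrow> 0) (at 0)"
    unfolding eigenvalues_mset_2x2_char_poly[OF M_red_carrier ev]
    by (rule tendsto_eq_rhs[OF tendsto_diff[OF tendsto_mult[OF
          tendsto_diff[OF tendsto_const lims(1)] tendsto_diff[OF tendsto_const lims(4)]]
          tendsto_mult[OF lims(2,3)]]]) simp
  moreover have "((\<lambda>\<alpha>. \<omega>\<^sub>1 \<alpha> + \<omega>\<^sub>2 \<alpha>) \<longlongrightarrow> s) (at 0)"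
    unfolding eigenvalues_mset_2x2_trace[OF M_red_carrier ev]
    using tendsto_add[OF lims(1,4)] by simp
  ultimately have lim: "(\<omega>\<^sub>1 \<longlongrightarrow> s) (at 0)" "(\<omega>\<^sub>2 \<longlongrightarrow> 0) (at 0)"
    using ordered_pair_limits[where a = \<omega>\<^sub>1 and b = \<omega>\<^sub>2, OF _ _ le] by blast+
  have "invertible_mat (block_mat L \<alpha> \<phi> \<psi>)
      \<and> eigenvalues_mset (M_mat L \<alpha> \<phi> \<psi>) = {#\<omega>\<^sub>1 \<alpha>, \<omega>\<^sub>2 \<alpha>#} + replicate_mset (2 * L - 2) 0"
    if d: "\<alpha> * \<phi> ^ L \<noteq> 1" for \<alpha>
  proof
    obtain B where B: "block_mat L \<alpha> \<phi> \<psi> * B = 1\<^sub>m (2 * L)" "B * block_mat L \<alpha> \<phi> \<psi> = 1\<^sub>m (2 * L)"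
      "B \<in> carrier_mat (2 * L) (2 * L)"
      using block_mat_inverse[OF L d] by blast
    then show "invertible_mat (block_mat L \<alpha> \<phi> \<psi>)"
      using carrier_matD[OF block_mat_carrier[of L \<alpha> \<phi> \<psi>]]
      by (auto simp: invertible_mat_def inverts_mat_def intro!: exI[of _ B])
    note M = M_mat_columns[OF L d assms(2,3), where \<psi> = \<psi>]
    \<comment> \<open>\<open>L - 1\<close> zero columns on either side of the two columns that can be non-zero\<close>
    have dims: "L - 1 + 2 + (L - 1) = 2 * L" "L - 1 + (L - 1) = 2 * L - 2" using L by auto
    have "eigenvalues_mset (M_mat L \<alpha> \<phi> \<psi>)
        = eigenvalues_mset (mat 2 2 (\<lambda>(i, j). M_mat L \<alpha> \<phi> \<psi> $$ (L - 1 + i, L - 1 + j)))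
          + replicate_mset (L - 1 + (L - 1)) 0"
      by (rule eigenvalues_mset_zero_columns_outside; unfold dims) (use M in auto)
    then show "eigenvalues_mset (M_mat L \<alpha> \<phi> \<psi>)
        = {#\<omega>\<^sub>1 \<alpha>, \<omega>\<^sub>2 \<alpha>#} + replicate_mset (2 * L - 2) 0"
      by (simp only: M(3) ev dims)
  qed
  with ev lim show ?thesis unfolding s_def by blast
qed

end
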